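(* Let $z>0$ and $d>0$ be real and let $\nu\ge0$ be an integer. Then $$\begin{aligned}I_2(z,d,\nu)=d^{\nu+1}\sum_{r=0}^\infty\frac{(-d)^r}{r!}\Bigg\{&-2\left(\frac{z^2}{4d}\right)^{1/2}\sum_{\ell=0}^\infty\frac{\left(\frac{z^2}{4d}\right)^\ell}{\ell!\left(\frac32\right)_\ell\left(\nu+r+\frac12-\ell\right)}+\sum_{\substack{\ell=0\\ \ell\ne\nu+r+1}}^\infty\frac{\left(\frac{z^2}{4d}\right)^\ell}{\ell!\left(\frac12\right)_\ell(\nu+r+1-\ell)}\\&+\frac{2\left(\frac{z^2}{4d}\right)^{\nu+r+1}}{(\nu+r+1)!\left(\frac32\right)_{\nu+r}}\left[-\log\left(\frac{z^2}{4d}\right)+A\right]\Bigg\},\end{aligned}$$ where $A$ (which depends on $\nu$ and $r$) is $$A=-2\gamma-2\log2+\left[1+\frac12+\cdots+\frac1{\nu+r+1}\right]+\left[\frac1{1/2}+\frac1{3/2}+\cdots+\frac1{(1/2)+\nu+r}\right].$$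
   Context: $I_2(z,d,\nu)=\int_0^d y^\nu e^{-y}e^{-zy^{-1/2}}\,dy$. $\gamma=0.5772156649\ldots$ is Euler's constant and $\log$ is the natural logarithm. Pochhammer symbol: $(a)_0=1$ and $(a)_r=a(a+1)\cdots(a+r-1)$ for integers $r\ge1$. *)

theory Defs
  imports "HOL-Analysis.Analysis"
begin

(* At the endpoint y = 0 the integrand takes the junk value given by 0 powr (-1/2) = 0;
   a single point does not affect the integral. *)
definition I2_integrand :: "real \<Rightarrow> nat \<Rightarrow> real \<Rightarrow> real" where
  "I2_integrand z \<nu> y = y ^ \<nu> * exp (- y) * exp (- z * y powr (- 1 / 2))"

definition I2 :: "real \<Rightarrow> real \<Rightarrow> nat \<Rightarrow> real" where
  "I2 z d \<nu> = integral {0..d} (I2_integrand z \<nu>)"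

(* In the following definitions u stands for z^2 / (4 d). *)

definition half_term :: "real \<Rightarrow> nat \<Rightarrow> nat \<Rightarrow> nat \<Rightarrow> real" where
  "half_term u \<nu> r l =
     u ^ l / (fact l * pochhammer (3 / 2) l * (real \<nu> + real r + 1 / 2 - real l))"

(* The index l = \<nu> + r + 1 is excluded from the series, i.e. contributes 0. *)
definition int_term :: "real \<Rightarrow> nat \<Rightarrow> nat \<Rightarrow> nat \<Rightarrow> real" where
  "int_term u \<nu> r l =
     (if l = \<nu> + r + 1 then 0
      else u ^ l / (fact l * pochhammer (1 / 2) l * (real \<nu> + real r + 1 - real l)))"

definition A_coeff :: "nat \<Rightarrow> nat \<Rightarrow> real" where
  "A_coeff \<nu> r = - 2 * euler_mascheroni - 2 * ln 2
     + (\<Sum>k = 1..\<nu> + r + 1. 1 / real k)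
     + (\<Sum>k = 0..\<nu> + r. 1 / (1 / 2 + real k))"

definition braced :: "real \<Rightarrow> nat \<Rightarrow> nat \<Rightarrow> real" where
  "braced u \<nu> r =
     - 2 * sqrt u * (\<Sum>l. half_term u \<nu> r l)
     + (\<Sum>l. int_term u \<nu> r l)
     + 2 * u ^ (\<nu> + r + 1) / (fact (\<nu> + r + 1) * pochhammer (3 / 2) (\<nu> + r))
       * (- ln u + A_coeff \<nu> r)"

end

(* Expanding exp (- y) reduces I_2 to the integrals of y^n exp (- z / sqrt y) over [0, d] with
   n = \<nu> + r, and dominated convergence justifies the exchange. The substitution s = z / sqrt y
   shows that such an integral is 2 z^(2 n + 2) \<Gamma>(- (2 n + 2), z / sqrt d). The upper incomplete
   Gamma function \<Gamma>(- m, x) is obtained from \<Gamma>(0, x) = E_1(x) by its recurrence in m, which also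
   yields its logarithmic series; the braces are 2 x^(2 n + 2) times this series at
   x = 2 sqrt u, split by the parity of the index. That the constant term of E_1 is - \<gamma> is equivalent to E_1(x) tending to 0 at
   infinity, which follows by comparing exp (- t) with (1 - t / n)^n on [0, n]. *)
theory Submission
  imports Defs
begin

section \<open>A series with one omitted index, and the incomplete Gamma function of negative
  integer order\<close>

definition exp_quot_term :: "nat \<Rightarrow> real \<Rightarrow> nat \<Rightarrow> real" where
  "exp_quot_term m x k = (if k = m then 0 else x ^ k / (fact k * (real k - real m)))"

text \<open>For \<open>x > 0\<close> this is \<open>x ^ m\<close> times the termwise antiderivative
  of \<open>exp x / x ^ Suc m\<close>, without the term \<open>k = m\<close>, whose antiderivative
  is logarithmic.\<close>

definition exp_quot :: "nat \<Rightarrow> real \<Rightarrow> real" where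
  "exp_quot m x = (\<Sum>k. exp_quot_term m x k)"

text \<open>For positive \<open>x\<close>, \<open>upper_Gamma_neg m x\<close> is the integral of \<open>t powr (- m - 1) * exp (- t)\<close>
  over \<open>t \<ge> x\<close>, that is, \<open>\<Gamma>(- m, x)\<close>.\<close>

fun upper_Gamma_neg :: "nat \<Rightarrow> real \<Rightarrow> real" where
  "upper_Gamma_neg 0 x = - euler_mascheroni - ln x - exp_quot 0 (- x)"
| "upper_Gamma_neg (Suc m) x = (exp (- x) / x ^ Suc m - upper_Gamma_neg m x) / real (Suc m)"

text \<open>Distinct naturals differ by at least 1, so the exponential series dominates.\<close>

lemma abs_exp_quot_term_le: "\<bar>exp_quot_term m x k\<bar> \<le> \<bar>x\<bar> ^ k / fact k"
proof (cases "k = m")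
  case False
  have "\<bar>x\<bar> ^ k / (fact k * \<bar>real k - real m\<bar>) \<le> \<bar>x\<bar> ^ k / (fact k * 1)"
    using False by (intro divide_left_mono mult_left_mono mult_pos_pos) auto
  with False show ?thesis
    by (simp add: exp_quot_term_def abs_mult power_abs)
qed (simp add: exp_quot_term_def)

lemma summable_power_over_fact: "summable (\<lambda>k. x ^ k / fact k)" for x :: real
  using summable_exp[of x] by (simp add: field_simps)

lemma summable_exp_quot_term: "summable (exp_quot_term m x)"
  by (rule summable_comparison_test'[OF summable_power_over_fact[of "\<bar>x\<bar>"], where N = 0])
    (simp add: abs_exp_quot_term_le)

lemma exp_quot_sums: "exp_quot_term m x sums exp_quot m x"
  unfolding exp_quot_def by (rule summable_sums[OF summable_exp_quot_term])

lemma exp_quot_0_0: "exp_quot 0 0 = 0"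
proof -
  have "exp_quot_term 0 0 = (\<lambda>k. 0)"
    by (auto simp: exp_quot_term_def)
  then show ?thesis by (simp add: exp_quot_def)
qed

text \<open>At an index \<open>k = Suc j\<close> with \<open>j \<noteq> m\<close>, writing
  \<open>Suc m\<close> as \<open>k - (j - m)\<close> splits the coefficient into that of
  \<open>x * exp_quot m x\<close> minus that of \<open>exp x\<close>. The isolated power compensates
  \<open>exp x\<close> at the omitted index \<open>Suc m\<close>.\<close>

lemma exp_quot_Suc:
  "real (Suc m) * exp_quot (Suc m) x = x ^ Suc m / fact (Suc m) - exp x + x * exp_quot m x"
proof -
  have "(\<lambda>k. case k of 0 \<Rightarrow> 0 | Suc j \<Rightarrow> x * exp_quot_term m x j) sums (x * exp_quot m x)"
    using sums_mult[OF exp_quot_sums[of m x], of x]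
    by (subst sums_Suc_iff[symmetric, where f = "\<lambda>k. case k of 0 \<Rightarrow> 0 | Suc j \<Rightarrow> x * exp_quot_term m x j", simplified])
      simp
  moreover have "(\<lambda>k. if k = Suc m then x ^ Suc m / fact (Suc m) else 0) sums (x ^ Suc m / fact (Suc m))"
    using sums_single[of "Suc m" "\<lambda>_. x ^ Suc m / fact (Suc m)"] by simp
  moreover have "(\<lambda>k. x ^ k / fact k) sums exp x"
    using exp_converges[of x] by (simp add: field_simps)
  ultimately have "(\<lambda>k. (if k = Suc m then x ^ Suc m / fact (Suc m) else 0) - x ^ k / fact k
        + (case k of 0 \<Rightarrow> 0 | Suc j \<Rightarrow> x * exp_quot_term m x j))
      sums (x ^ Suc m / fact (Suc m) - exp x + x * exp_quot m x)"
    by (intro sums_add sums_diff)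
  moreover have "(if k = Suc m then x ^ Suc m / fact (Suc m) else 0) - x ^ k / fact k
        + (case k of 0 \<Rightarrow> 0 | Suc j \<Rightarrow> x * exp_quot_term m x j)
      = real (Suc m) * exp_quot_term (Suc m) x k" for k
  proof (cases k)
    case 0
    then show ?thesis by (simp add: exp_quot_term_def field_simps)
  next
    case (Suc j)
    show ?thesis
    proof (cases "j = m")
      case True
      with Suc show ?thesis by (simp add: exp_quot_term_def)
    next
      case False
      then have ne: "real j - real m \<noteq> 0" by simp
      have "x ^ Suc j / (fact j * (real j - real m)) - x ^ Suc j / (real (Suc j) * fact j)
          = real (Suc m) * (x ^ Suc j / (real (Suc j) * fact j * (real j - real m)))"
        using ne by (simp add: divide_simps del: of_nat_Suc) (simp add: algebra_simps)
      with Suc False show ?thesis by (simp add: exp_quot_term_def algebra_simps)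
    qed
  qed
  ultimately have "(\<lambda>k. real (Suc m) * exp_quot_term (Suc m) x k)
      sums (x ^ Suc m / fact (Suc m) - exp x + x * exp_quot m x)"
    by simp
  from sums_unique2[OF sums_mult[OF exp_quot_sums] this] show ?thesis .
qed

section \<open>Derivatives of the two functions\<close>

lemma exp_quot_0_power_series:
  defines "c \<equiv> (\<lambda>k. if k = 0 then 0 else 1 / (fact k * real k))"
  shows "exp_quot 0 = (\<lambda>x. \<Sum>k. c k * x ^ k)" and "summable (\<lambda>k. c k * x ^ k)"
    and "diffs c = (\<lambda>k. 1 / fact (Suc k))"
proof -
  have c: "exp_quot_term 0 y = (\<lambda>k. c k * y ^ k)" for y
    by (auto simp: exp_quot_term_def c_def)
  show "exp_quot 0 = (\<lambda>x. \<Sum>k. c k * x ^ k)"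
    by (simp add: exp_quot_def c fun_eq_iff)
  show "summable (\<lambda>k. c k * x ^ k)"
    using summable_exp_quot_term[of 0 x] by (simp add: c)
  show "diffs c = (\<lambda>k. 1 / fact (Suc k))"
    by (auto simp: diffs_def c_def simp del: of_nat_Suc)
qed

text \<open>At 0 the quotient would read 0 by convention, while the derivative there is 1.\<close>

lemma exp_quot_0_has_real_derivative:
  assumes "x \<noteq> 0"
  shows "(exp_quot 0 has_real_derivative (exp x - 1) / x) (at x)"
proof -
  have "(\<lambda>k. x ^ k / fact k) sums exp x"
    using exp_converges[of x] by (simp add: field_simps)
  then have "(\<lambda>k. x ^ Suc k / fact (Suc k)) sums (exp x - 1)"
    by (subst sums_Suc_iff) simp
  from sums_divide[OF this, of x] have "(\<lambda>k. 1 / fact (Suc k) * x ^ k) sums ((exp x - 1) / x)"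
    using assms by simp
  with termdiffs_strong_converges_everywhere[OF exp_quot_0_power_series(2), of x] show ?thesis
    by (simp add: exp_quot_0_power_series(1,3) sums_iff)
qed

text \<open>This covers 0 as well, as the monotonicity arguments on \<open>[0, n]\<close>
  require.\<close>

lemma isCont_exp_quot_0: "isCont (exp_quot 0) x"
  unfolding exp_quot_0_power_series(1)
  by (rule isCont_powser_converges_everywhere) (rule exp_quot_0_power_series(2))

lemma exp_quot_0_uminus_has_real_derivative:
  assumes "x \<noteq> 0"
  shows "((\<lambda>x. exp_quot 0 (- x)) has_real_derivative (exp (- x) - 1) / x) (at x)"
proof -
  have "((\<lambda>x. exp_quot 0 (- x)) has_real_derivative (exp (- x) - 1) / (- x) * (- 1)) (at x)"
    by (rule DERIV_chain2[OF exp_quot_0_has_real_derivative])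
      (use assms in \<open>auto intro!: derivative_eq_intros\<close>)
  then show ?thesis by simp
qed

text \<open>Integration by parts in differential form: the derivative of the preceding function
  cancels the part of the quotient rule that has \<open>x ^ Suc m\<close> in the
  denominator.\<close>

lemma upper_Gamma_neg_has_real_derivative:
  assumes "x > 0"
  shows "(upper_Gamma_neg m has_real_derivative - exp (- x) / x ^ Suc m) (at x)"
proof (induction m)
  case 0
  have "((\<lambda>x. - euler_mascheroni - ln x - exp_quot 0 (- x)) has_real_derivative
      0 - 1 / x - (exp (- x) - 1) / x) (at x)"
    using assms by (intro DERIV_diff exp_quot_0_uminus_has_real_derivative)
      (auto intro!: derivative_eq_intros)
  moreover have "(\<lambda>x. - euler_mascheroni - ln x - exp_quot 0 (- x)) = upper_Gamma_neg 0"
    by (simp add: fun_eq_iff)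
  moreover have "0 - 1 / x - (exp (- x) - 1) / x = - exp (- x) / x ^ Suc 0"
    using assms by (simp add: field_simps)
  ultimately show ?case
    by metis
next
  case (Suc m)
  have "((\<lambda>x. (exp (- x) / x ^ Suc m - upper_Gamma_neg m x) / real (Suc m)) has_real_derivative
      ((- exp (- x) * x ^ Suc m - exp (- x) * (real (Suc m) * x ^ m)) / (x ^ Suc m * x ^ Suc m)
        - (- exp (- x) / x ^ Suc m)) / real (Suc m)) (at x)"
    using assms DERIV_pow[of "Suc m" x]
    by (intro DERIV_cdivide DERIV_diff[OF DERIV_divide Suc.IH])
      (auto intro!: derivative_eq_intros simp del: of_nat_Suc power_Suc)
  also have "((- exp (- x) * x ^ Suc m - exp (- x) * (real (Suc m) * x ^ m)) / (x ^ Suc m * x ^ Suc m)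
        - (- exp (- x) / x ^ Suc m)) / real (Suc m) = - exp (- x) / x ^ Suc (Suc m)"
    using assms by (simp add: divide_simps del: of_nat_Suc)
  finally show ?case by (simp add: fun_eq_iff del: of_nat_Suc power_Suc)
qed

section \<open>Euler's constant as the constant term of the exponential integral\<close>

lemma exp_minus_approx:
  fixes t :: real
  assumes "0 \<le> t" "t \<le> real n" "n > 0"
  shows "(1 - t / n) ^ n \<le> exp (- t)"
    and "exp (- t) - (1 - t / n) ^ n \<le> t\<^sup>2 * exp (- t) / n"
proof -
  define s where "s = t / n"
  have s: "0 \<le> s" "s \<le> 1" and t: "t = n * s"
    using assms by (auto simp: s_def)
  have "(1 - s) ^ n \<le> exp (- s) ^ n"
    using s exp_ge_add_one_self[of "- s"] by (intro power_mono) auto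
  then show "(1 - t / n) ^ n \<le> exp (- t)"
    by (simp add: s_def[symmetric] exp_of_nat_mult[symmetric] t)
  \<comment> \<open>Bernoulli's inequality bounds \<open>(1 - s\<^sup>2) ^ n\<close> from below;
    factoring it and using \<open>1 + s \<le> exp s\<close> bounds it from above by
    \<open>(1 - s) ^ n * exp t\<close>.\<close>
  have "1 + real n * (- (s\<^sup>2)) \<le> (1 + (- (s\<^sup>2))) ^ n"
    using s by (intro Bernoulli_inequality) (auto simp: power_le_one)
  also have "1 + (- (s\<^sup>2)) = (1 - s) * (1 + s)"
    by (simp add: power2_eq_square algebra_simps)
  also have "((1 - s) * (1 + s)) ^ n \<le> ((1 - s) * exp s) ^ n"
    using s exp_ge_add_one_self[of s] by (intro power_mono mult_left_mono) auto
  also have "\<dots> = (1 - s) ^ n * exp t"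
    by (simp add: power_mult_distrib exp_of_nat_mult[symmetric] t)
  finally have "(1 - real n * s\<^sup>2) * exp (- t) \<le> (1 - s) ^ n * exp t * exp (- t)"
    by (intro mult_right_mono) auto
  also have "\<dots> = (1 - s) ^ n"
    by (simp add: exp_minus)
  also have "real n * s\<^sup>2 = t\<^sup>2 / n"
    using assms by (simp add: s_def power2_eq_square)
  finally show "exp (- t) - (1 - t / n) ^ n \<le> t\<^sup>2 * exp (- t) / n"
    by (simp add: s_def algebra_simps)
qed

text \<open>The sum is the integral of \<open>(exp (- t) - (1 - t / n) ^ n) / t\<close> over
  \<open>[0, n]\<close>, which \<open>exp_minus_approx\<close> places between 0 and the integral of
  \<open>t * exp (- t) / n\<close>. Monotone auxiliary functions stand in for the integrals.\<close>

lemma harm_plus_exp_quot_bounds: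
  assumes "n > 0"
  shows "0 \<le> harm n + exp_quot 0 (- real n)" and "harm n + exp_quot 0 (- real n) \<le> 1 / real n"
proof -
  \<comment> \<open>\<open>D x\<close> is the integral of \<open>(1 - (1 - t / n) ^ n) / t\<close> over \<open>[0, x]\<close>, and \<open>- exp_quot 0 (- x)\<close>
    is that of \<open>(1 - exp (- t)) / t\<close>.\<close>
  define D where "D = (\<lambda>x::real. \<Sum>j=1..n. (1 - (1 - x / n) ^ j) / j)"
  define q where "q = (\<lambda>x. D x + exp_quot 0 (- x))"
  have dD: "(D has_real_derivative (1 - (1 - x / n) ^ n) / x) (at x)" if "x > 0" for x
  proof -
    have "(D has_real_derivative (\<Sum>j=1..n. (1 - x / n) ^ (j - 1) / n)) (at x)"
      unfolding D_def using assms
      by (auto intro!: derivative_eq_intros sum.cong)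
    also have "(\<Sum>j=1..n. (1 - x / n) ^ (j - 1) / n) = (\<Sum>j<n. (1 - x / n) ^ j) / n"
      by (simp add: sum_divide_distrib[symmetric] sum.atLeast1_atMost_eq)
    also have "\<dots> = (1 - (1 - x / n) ^ n) / x"
      using that assms by (subst sum_gp_strict) (auto simp: divide_simps)
    finally show ?thesis .
  qed
  have dq: "(q has_real_derivative (exp (- x) - (1 - x / n) ^ n) / x) (at x)" if "x > 0" for x
    using DERIV_add[OF dD[OF that] exp_quot_0_uminus_has_real_derivative[of x]] that
    by (simp add: q_def add_divide_distrib[symmetric])
  have cont: "continuous_on {0..real n} q"
    unfolding q_def D_def
    by (intro continuous_intros continuous_at_imp_continuous_on ballI
        isCont_o2[OF _ isCont_exp_quot_0] assms) (use assms in auto)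
  have q0: "q 0 = 0" by (simp add: q_def D_def exp_quot_0_0)
  \<comment> \<open>At \<open>x = n\<close> every power in \<open>D\<close> vanishes, which leaves
    the harmonic sum.\<close>
  have qn: "q (real n) = harm n + exp_quot 0 (- real n)"
    using assms by (auto simp: q_def D_def harm_def inverse_eq_divide power_0_left intro!: sum.cong)
  have "q 0 \<le> q (real n)"
  proof (rule DERIV_nonneg_imp_increasing_open[where f = q])
    fix x :: real assume x: "0 < x" "x < real n"
    then show "\<exists>y. (q has_real_derivative y) (at x) \<and> 0 \<le> y"
      using dq[OF x(1)] exp_minus_approx(1)[of x n] assms by (intro exI conjI) auto
  qed (use cont in auto)
  then show "0 \<le> harm n + exp_quot 0 (- real n)"
    by (simp add: q0 qn)
  \<comment> \<open>\<open>- (1 + x) * exp (- x)\<close> is an antiderivative of \<open>x * exp (- x)\<close>, which bounds \<open>n\<close> times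
    the derivative of \<open>q\<close>.\<close>
  define p where "p = (\<lambda>x. - (1 + x) * exp (- x) / n - q x)"
  have "p 0 \<le> p (real n)"
  proof (rule DERIV_nonneg_imp_increasing_open[where f = p])
    fix x :: real assume x: "0 < x" "x < real n"
    have "(p has_real_derivative x * exp (- x) / n - (exp (- x) - (1 - x / n) ^ n) / x) (at x)"
      unfolding p_def using assms
      by (intro DERIV_diff dq x) (auto intro!: derivative_eq_intros simp: field_simps)
    moreover have "(exp (- x) - (1 - x / n) ^ n) / x \<le> (x\<^sup>2 * exp (- x) / n) / x"
      using exp_minus_approx(2)[of x n] x assms by (intro divide_right_mono) auto
    ultimately show "\<exists>y. (p has_real_derivative y) (at x) \<and> 0 \<le> y"
      using x by (intro exI conjI) (auto simp: power2_eq_square)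
  next
    show "continuous_on {0..real n} p"
      unfolding p_def by (intro continuous_intros cont) (use assms in auto)
  qed auto
  \<comment> \<open>The final bound comes from \<open>p 0 = - 1 / n\<close>.\<close>
  also have "p (real n) \<le> - q (real n)"
    by (simp add: p_def mult_nonpos_nonneg divide_nonpos_nonneg)
  finally show "harm n + exp_quot 0 (- real n) \<le> 1 / real n"
    by (simp add: p_def q0 qn)
qed

section \<open>Behaviour at infinity\<close>

text \<open>The value at \<open>n\<close> is \<open>harm n - ln n - euler_mascheroni\<close> minus
  \<open>harm n + exp_quot 0 (- n)\<close>, and both tend to 0.\<close>

lemma upper_Gamma_neg_0_LIMSEQ: "(\<lambda>n. upper_Gamma_neg 0 (real n)) \<longlonglongrightarrow> 0"
proof -
  have "(\<lambda>n. harm n + exp_quot 0 (- real n)) \<longlonglongrightarrow> 0"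
    by (rule tendsto_sandwich[OF _ _ tendsto_const lim_1_over_n])
      (auto intro!: eventually_mono[OF eventually_gt_at_top[of 0]] harm_plus_exp_quot_bounds)
  from tendsto_diff[OF tendsto_diff[OF euler_mascheroni_LIMSEQ tendsto_const[of euler_mascheroni]] this]
  show ?thesis by (simp add: algebra_simps)
qed

lemma upper_Gamma_neg_0_antimono:
  assumes "0 < x" "x \<le> y"
  shows "upper_Gamma_neg 0 y \<le> upper_Gamma_neg 0 x"
proof (rule DERIV_nonpos_imp_nonincreasing[OF assms(2)])
  fix t assume "x \<le> t" "t \<le> y"
  then show "\<exists>d. (upper_Gamma_neg 0 has_real_derivative d) (at t) \<and> d \<le> 0"
    using upper_Gamma_neg_has_real_derivative[of t 0] assms by (intro exI conjI) auto
qed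

lemma upper_Gamma_neg_tendsto_0: "(upper_Gamma_neg m \<longlongrightarrow> 0) at_top"
proof (induction m)
  case 0
  \<comment> \<open>A decreasing function stays above its limit along the integers.\<close>
  have nonneg: "0 \<le> upper_Gamma_neg 0 x" if "x > 0" for x
  proof (rule LIMSEQ_le_const2[OF upper_Gamma_neg_0_LIMSEQ])
    show "\<exists>N. \<forall>n\<ge>N. upper_Gamma_neg 0 (real n) \<le> upper_Gamma_neg 0 x"
      using that by (intro exI[of _ "nat \<lceil>x\<rceil>"] allI impI upper_Gamma_neg_0_antimono) linarith+
  qed
  \<comment> \<open>Rounding down turns the limit along the integers into an upper bound at real
    arguments.\<close>
  have lim: "((\<lambda>x::real. upper_Gamma_neg 0 (real (nat \<lfloor>x\<rfloor>))) \<longlongrightarrow> 0) at_top"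
    by (rule filterlim_compose[OF upper_Gamma_neg_0_LIMSEQ])
      (intro filterlim_compose[OF filterlim_nat_sequentially filterlim_floor_sequentially])
  show ?case
  proof (rule tendsto_sandwich[OF _ _ tendsto_const lim])
    show "eventually (\<lambda>x. 0 \<le> upper_Gamma_neg 0 x) at_top"
      by (intro eventually_mono[OF eventually_gt_at_top[of 0]] nonneg)
    show "eventually (\<lambda>x. upper_Gamma_neg 0 x \<le> upper_Gamma_neg 0 (real (nat \<lfloor>x\<rfloor>))) at_top"
      by (intro eventually_mono[OF eventually_ge_at_top[of 1]] upper_Gamma_neg_0_antimono) linarith+
  qed
next
  case (Suc m)
  have lim: "((\<lambda>x::real. exp (- x)) \<longlongrightarrow> 0) at_top"
    by (rule filterlim_compose[OF exp_at_bot filterlim_uminus_at_bot_at_top])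
  have "((\<lambda>x::real. exp (- x) / x ^ Suc m) \<longlongrightarrow> 0) at_top"
  proof (rule tendsto_sandwich[OF _ _ tendsto_const lim])
    show "eventually (\<lambda>x::real. 0 \<le> exp (- x) / x ^ Suc m) at_top"
      by (intro eventually_mono[OF eventually_gt_at_top[of 0]]) auto
    show "eventually (\<lambda>x::real. exp (- x) / x ^ Suc m \<le> exp (- x)) at_top"
    proof (rule eventually_mono[OF eventually_ge_at_top[of 1]])
      fix x :: real assume "x \<ge> 1"
      then have "1 \<le> x ^ Suc m" by (rule one_le_power)
      then have "exp (- x) / x ^ Suc m \<le> exp (- x) / 1"
        by (intro divide_left_mono) (auto simp del: power_Suc)
      then show "exp (- x) / x ^ Suc m \<le> exp (- x)" by simp
    qed
  qed
  from tendsto_divide[OF tendsto_diff[OF this Suc.IH] tendsto_const[of "real (Suc m)"]]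
  show ?case by (simp del: of_nat_Suc power_Suc)
qed

section \<open>The logarithmic series\<close>

text \<open>The recurrences of \<open>upper_Gamma_neg\<close> and \<open>exp_quot\<close> match; the
  isolated power in \<open>exp_quot_Suc\<close> supplies the summand \<open>1 / Suc m\<close> that
  turns \<open>harm m\<close> into \<open>harm (Suc m)\<close>.\<close>

lemma upper_Gamma_neg_series:
  assumes "x > 0"
  shows "x ^ m * upper_Gamma_neg m x
    = (- x) ^ m / fact m * (harm m - euler_mascheroni - ln x) - exp_quot m (- x)"
proof (induction m)
  case 0
  show ?case by (simp add: harm_def)
next
  case (Suc m)
  define L where "L = euler_mascheroni + ln x"
  have "real (Suc m) * (x ^ Suc m * upper_Gamma_neg (Suc m) x) = exp (- x) - x * (x ^ m * upper_Gamma_neg m x)"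
    using assms by (simp add: field_simps del: of_nat_Suc)
  also have "\<dots> = exp (- x) + (- x) ^ Suc m / fact m * (harm m - L) + x * exp_quot m (- x)"
    by (simp add: Suc.IH algebra_simps L_def)
  also have "\<dots> = (- x) ^ Suc m / fact m * (harm m - L) + (- x) ^ Suc m / fact (Suc m)
      - real (Suc m) * exp_quot (Suc m) (- x)"
    by (simp add: exp_quot_Suc del: of_nat_Suc)
  also have "(- x) ^ Suc m / fact m * (harm m - L) + (- x) ^ Suc m / fact (Suc m)
      = real (Suc m) * ((- x) ^ Suc m / fact (Suc m) * (harm (Suc m) - L))"
  proof -
    have "p / f * (h - L) + p / (s * f) = s * (p / (s * f) * (h + 1 / s - L))"
      if "s \<noteq> 0" "f \<noteq> 0" for p f h s :: real
      using that by (simp add: field_simps)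
    from this[of "real (Suc m)" "fact m" "(- x) ^ Suc m" "harm m"] show ?thesis
      by (simp add: harm_Suc inverse_eq_divide del: of_nat_Suc power_Suc)
  qed
  finally have "real (Suc m) * (x ^ Suc m * upper_Gamma_neg (Suc m) x)
     = real (Suc m) * ((- x) ^ Suc m / fact (Suc m) * (harm (Suc m) - L) - exp_quot (Suc m) (- x))"
    by (simp add: algebra_simps)
  then have "x ^ Suc m * upper_Gamma_neg (Suc m) x
     = (- x) ^ Suc m / fact (Suc m) * (harm (Suc m) - L) - exp_quot (Suc m) (- x)"
    by (subst (asm) mult_cancel_left) (simp del: of_nat_Suc power_Suc upper_Gamma_neg.simps)
  then show ?case by (simp add: L_def diff_diff_eq)
qed

section \<open>Splitting the series by parity\<close>

lemma fact_Suc_double: "(fact (Suc (2 * l)) :: real) = 4 ^ l * fact l * pochhammer (3 / 2) l"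
proof (induction l)
  case (Suc l)
  have "(fact (Suc (2 * Suc l)) :: real) = real (2 * l + 3) * real (2 * l + 2) * fact (Suc (2 * l))"
    by simp
  also have "\<dots> = 4 ^ Suc l * fact (Suc l) * pochhammer (3 / 2) (Suc l)"
    unfolding Suc.IH by (simp add: pochhammer_Suc algebra_simps)
  finally show ?case .
qed simp

text \<open>The difference of the indices is \<open>- 2\<close> times the linear factor in
  \<open>int_term\<close>, which absorbs the prefactor; the omitted index is the one with
  \<open>l = \<nu> + r + 1\<close>.\<close>

lemma exp_quot_term_even:
  assumes "u \<ge> 0"
  shows "- 2 * exp_quot_term (2 * (\<nu> + r + 1)) (- (2 * sqrt u)) (2 * l) = int_term u \<nu> r l"
proof (cases "l = \<nu> + r + 1")
  case False
  have pow: "(- (2 * sqrt u)) ^ (2 * l) = 4 ^ l * u ^ l"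
    using assms by (simp add: power_mult power_mult_distrib)
  have fact: "(fact (2 * l) :: real) = 4 ^ l * pochhammer (1 / 2) l * fact l"
    by (simp add: fact_double power_mult)
  have "pochhammer (1 / 2) l \<noteq> (0::real)"
    by (simp add: pochhammer_pos less_imp_neq[THEN not_sym])
  moreover define D where "D = real \<nu> + real r + 1 - real l"
  moreover have "D \<noteq> 0"
    using False unfolding D_def by linarith
  moreover have "real (2 * l) - real (2 * (\<nu> + r + 1)) = - 2 * D"
    by (simp add: D_def)
  ultimately show ?thesis
    using False unfolding exp_quot_term_def int_term_def pow fact
    by (simp add: D_def[symmetric])
qed (simp add: exp_quot_term_def int_term_def)

text \<open>An odd index never meets the omitted even one, so \<open>half_term\<close> has no
  exceptional case.\<close>

lemma exp_quot_term_odd: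
  assumes "u \<ge> 0"
  shows "- 2 * exp_quot_term (2 * (\<nu> + r + 1)) (- (2 * sqrt u)) (Suc (2 * l))
    = - 2 * sqrt u * half_term u \<nu> r l"
proof -
  have pow: "(- (2 * sqrt u)) ^ Suc (2 * l) = - 2 * sqrt u * (4 ^ l * u ^ l)"
    using assms by (simp add: power_mult power_mult_distrib)
  have "pochhammer (3 / 2) l \<noteq> (0::real)"
    by (simp add: pochhammer_pos less_imp_neq[THEN not_sym])
  moreover define D where "D = real \<nu> + real r + 1 / 2 - real l"
  moreover have "D \<noteq> 0"
  proof
    assume "D = 0"
    then have "real (2 * \<nu> + 2 * r + 1) = real (2 * l)" by (simp add: D_def)
    then show False unfolding of_nat_eq_iff by presburger
  qed
  moreover have "real (Suc (2 * l)) - real (2 * (\<nu> + r + 1)) = - 2 * D"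
    by (simp add: D_def)
  moreover have "Suc (2 * l) \<noteq> 2 * (\<nu> + r + 1)"
    by presburger
  ultimately show ?thesis
    unfolding exp_quot_term_def half_term_def pow fact_Suc_double
    by (simp add: D_def[symmetric] del: mult_Suc_right of_nat_Suc)
qed

lemma summable_exp_quot_term_subseq:
  assumes "inj g"
  shows "summable (\<lambda>l. exp_quot_term m x (g l))"
proof (rule summable_comparison_test')
  show "summable ((\<lambda>k. \<bar>x\<bar> ^ k / fact k) \<circ> g)"
    by (rule summable_reindex[OF summable_power_over_fact assms]) simp
qed (simp add: abs_exp_quot_term_le)

lemma summable_int_term: "u \<ge> 0 \<Longrightarrow> summable (int_term u \<nu> r)"
  using summable_mult[OF summable_exp_quot_term_subseq[of "\<lambda>l. 2 * l" "2 * (\<nu> + r + 1)" "- (2 * sqrt u)"], of "- 2"]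
  by (simp only: exp_quot_term_even) (simp add: inj_on_def)

lemma summable_half_term:
  assumes "u > 0"
  shows "summable (half_term u \<nu> r)"
proof -
  have "summable (\<lambda>l. - 2 * exp_quot_term (2 * (\<nu> + r + 1)) (- (2 * sqrt u)) (Suc (2 * l)))"
    by (intro summable_mult summable_exp_quot_term_subseq) (simp add: inj_on_def)
  then have "summable (\<lambda>l. - 2 * sqrt u * half_term u \<nu> r l)"
    using assms by (simp only: exp_quot_term_odd less_imp_le)
  then show ?thesis
    using assms by (subst (asm) summable_cmult_iff) simp
qed

lemma double_exp_quot_eq:
  assumes "u > 0"
  shows "- 2 * exp_quot (2 * (\<nu> + r + 1)) (- (2 * sqrt u))
    = - 2 * sqrt u * (\<Sum>l. half_term u \<nu> r l) + (\<Sum>l. int_term u \<nu> r l)"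
proof -
  let ?T = "\<lambda>k. - 2 * exp_quot_term (2 * (\<nu> + r + 1)) (- (2 * sqrt u)) k"
  have "(\<lambda>k. if even k then int_term u \<nu> r (k div 2) else - 2 * sqrt u * half_term u \<nu> r ((k - 1) div 2))
      sums (- 2 * sqrt u * (\<Sum>l. half_term u \<nu> r l) + (\<Sum>l. int_term u \<nu> r l))"
    using assms
    by (intro sums_if sums_mult summable_sums summable_half_term summable_int_term) auto
  moreover have "(if even k then int_term u \<nu> r (k div 2)
      else - 2 * sqrt u * half_term u \<nu> r ((k - 1) div 2)) = ?T k" for k
  proof (cases "even k")
    case True
    then show ?thesis
      using exp_quot_term_even[of u \<nu> r "k div 2"] assms by simp
  next
    case False
    then show ?thesis
      using exp_quot_term_odd[of u \<nu> r "(k - 1) div 2"] assms by (auto elim!: oddE)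
  qed
  ultimately have "?T sums (- 2 * sqrt u * (\<Sum>l. half_term u \<nu> r l) + (\<Sum>l. int_term u \<nu> r l))"
    by simp
  then show ?thesis
    by (rule sums_unique2[OF sums_mult[OF exp_quot_sums]])
qed

section \<open>Identification of the braces\<close>

text \<open>Even indices \<open>2 * k\<close> contribute \<open>1 / k\<close> and odd ones
  \<open>2 * k + 1\<close> contribute \<open>1 / (1 / 2 + k)\<close>; these are the two sums in
  \<open>A_coeff\<close>.\<close>

lemma double_harm_even:
  "2 * harm (2 * Suc n) = (\<Sum>k=1..Suc n. 1 / real k) + (\<Sum>k=0..n. 1 / (1 / 2 + real k))"
proof (induction n)
  case 0
  show ?case by (simp add: harm_def numeral_2_eq_2)
next
  case (Suc n)
  have "harm (2 * Suc (Suc n)) = harm (2 * Suc n) + 1 / real (2 * n + 3) + 1 / real (2 * n + 4)"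
    by (simp add: harm_Suc inverse_eq_divide add_ac)
  then have "2 * harm (2 * Suc (Suc n)) = 2 * harm (2 * Suc n) + 2 / real (2 * n + 3) + 2 / real (2 * n + 4)"
    by simp
  also have "2 / real (2 * n + 3) = 1 / (1 / 2 + real (Suc n))"
    by (simp add: field_simps)
  also have "2 / real (2 * n + 4) = 1 / real (Suc (Suc n))"
    by (simp add: field_simps)
  finally show ?case
    unfolding Suc.IH by simp
qed

lemma braced_eq_upper_Gamma_neg:
  fixes \<nu> r :: nat
  assumes "u > 0"
  defines "a \<equiv> 2 * sqrt u" and "m \<equiv> 2 * (\<nu> + r + 1)"
  shows "braced u \<nu> r = 2 * (a ^ m * upper_Gamma_neg m a)"
proof -
  let ?n = "\<nu> + r"
  have a: "a > 0" using assms by simp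
  have "ln a = ln 2 + ln u / 2"
    using assms by (simp add: a_def ln_mult ln_sqrt)
  moreover have "2 * harm m = (\<Sum>k=1..?n + 1. 1 / real k) + (\<Sum>k=0..?n. 1 / (1 / 2 + real k))"
    using double_harm_even[of ?n] by (simp add: m_def)
  \<comment> \<open>The terms \<open>- 2 * ln 2\<close> and \<open>- ln u\<close> both come from
    \<open>- 2 * ln a\<close>.\<close>
  ultimately have A: "- ln u + A_coeff \<nu> r = 2 * (harm m - euler_mascheroni - ln a)"
    unfolding A_coeff_def by simp
  have "(- a) ^ m = 4 ^ (?n + 1) * u ^ (?n + 1)"
    using assms unfolding m_def a_def by (subst power_mult) (simp add: power_mult_distrib)
  moreover have "(fact m :: real) = 4 ^ (?n + 1) * pochhammer (1 / 2) (?n + 1) * fact (?n + 1)"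
    using power_mult[of "2::real" 2 "?n + 1"] by (simp only: m_def fact_double) simp
  moreover have "pochhammer (3 / 2) ?n = (2::real) * pochhammer (1 / 2) (?n + 1)"
    using pochhammer_rec[of "1 / 2 :: real" ?n] by simp
  ultimately have "(- a) ^ m / fact m = 2 * u ^ (?n + 1) / (fact (?n + 1) * pochhammer (3 / 2) ?n)"
    by simp
  then show ?thesis
    unfolding braced_def upper_Gamma_neg_series[OF a] A
    using double_exp_quot_eq[OF assms(1), of \<nu> r, folded a_def m_def]
    by (simp add: algebra_simps)
qed

section \<open>Powers integrated against \<open>exp (- z / sqrt y)\<close>\<close>

text \<open>Both sides default to 0 at \<open>y = 0\<close>, so the rewriting is valid on all of
  \<open>[0, d]\<close>.\<close>

lemma powr_minus_half_eq: "y \<ge> 0 \<Longrightarrow> y powr - (1 / 2) = 1 / sqrt y" for y :: real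
  using powr_minus[of y "1 / 2"] by (simp add: powr_half_sqrt inverse_eq_divide)

text \<open>Chain rule with inner function \<open>z / sqrt y\<close>; with order
  \<open>2 * n + 2\<close> all powers of \<open>z\<close> cancel and exactly \<open>y ^ n\<close>
  remains.\<close>

lemma upper_Gamma_neg_antiderivative:
  assumes "z > 0" "y > 0"
  shows "((\<lambda>y. 2 * z ^ (2 * n + 2) * upper_Gamma_neg (2 * n + 2) (z / sqrt y))
    has_real_derivative y ^ n * exp (- (z / sqrt y))) (at y)"
proof -
  define s where "s = sqrt y"
  have s: "s > 0" and y: "y = s\<^sup>2" using assms by (auto simp: s_def)
  have "((\<lambda>y. z / sqrt y) has_real_derivative - (z / (2 * s ^ 3))) (at y)"
    using assms s
    by (auto intro!: derivative_eq_intros simp: s_def[symmetric] field_simps power2_eq_square power3_eq_cube)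
  then have "((\<lambda>y. 2 * z ^ (2 * n + 2) * upper_Gamma_neg (2 * n + 2) (z / sqrt y)) has_real_derivative
      2 * z ^ (2 * n + 2) * (- exp (- (z / sqrt y)) / (z / sqrt y) ^ Suc (2 * n + 2) * - (z / (2 * s ^ 3)))) (at y)"
    using assms by (intro DERIV_cmult DERIV_chain2[OF upper_Gamma_neg_has_real_derivative]) auto
  also have "2 * z ^ (2 * n + 2) * (- exp (- (z / sqrt y)) / (z / sqrt y) ^ Suc (2 * n + 2) * - (z / (2 * s ^ 3)))
      = exp (- (z / sqrt y)) * (z ^ (2 * n + 3) / (z / s) ^ (2 * n + 3) / s ^ 3)"
    using s assms by (simp add: s_def[symmetric] eval_nat_numeral)
  also have "z ^ (2 * n + 3) / (z / s) ^ (2 * n + 3) / s ^ 3 = y ^ n"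
    using s assms by (simp add: power_divide power_add y power_mult)
  finally show ?thesis by (simp add: mult.commute)
qed

lemma power_exp_has_integral:
  assumes "z > 0" "d > 0"
  shows "((\<lambda>y. y ^ (\<nu> + r) * exp (- z * y powr (- 1 / 2))) has_integral
    d ^ (\<nu> + r + 1) * braced (z ^ 2 / (4 * d)) \<nu> r) {0..d}"
proof -
  define n where "n = \<nu> + r"
  define G where "G = (\<lambda>y. 2 * z ^ (2 * n + 2) * upper_Gamma_neg (2 * n + 2) (z / sqrt y))"
  \<comment> \<open>As \<open>y\<close> decreases to 0, \<open>z / sqrt y\<close> tends to infinity
    and \<open>G y\<close> to 0. The formula for \<open>G\<close> would evaluate at
    \<open>z / 0 = 0\<close> instead, so the value at 0 is set by hand.\<close>
  define F where "F = (\<lambda>y. if y \<le> 0 then 0 else G y)"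
  have dF: "(F has_real_derivative y ^ n * exp (- (z / sqrt y))) (at y)" if "y > 0" for y
  proof (rule has_field_derivative_transform_within_open)
    show "(G has_real_derivative y ^ n * exp (- (z / sqrt y))) (at y)"
      unfolding G_def by (rule upper_Gamma_neg_antiderivative[OF assms(1) that])
  qed (use that in \<open>auto simp: F_def intro: open_greaterThan[of 0]\<close>)
  have "filterlim (\<lambda>y. z * inverse (sqrt y)) at_top (at_right 0)"
  proof (rule filterlim_tendsto_pos_mult_at_top[OF tendsto_const assms(1)], rule filterlim_inverse_at_top)
    have "(sqrt \<longlongrightarrow> sqrt 0) (at_right 0)"
      by (intro tendsto_intros)
    then show "(sqrt \<longlongrightarrow> 0) (at_right 0)" by simp
    show "\<forall>\<^sub>F y in at_right 0. 0 < sqrt y"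
      by (simp add: eventually_at_right_less)
  qed
  from tendsto_mult[OF tendsto_const filterlim_compose[OF upper_Gamma_neg_tendsto_0 this]]
  have "(G \<longlongrightarrow> 0) (at_right 0)"
    by (simp add: G_def divide_inverse del: upper_Gamma_neg.simps)
  moreover have "\<forall>\<^sub>F y in at_right 0. G y = F y"
    using eventually_at_right_less[of "0::real"] by eventually_elim (simp add: F_def)
  ultimately have F0: "(F \<longlongrightarrow> 0) (at_right 0)"
    by (rule Lim_transform_eventually)
  have "continuous_on {0..d} F"
  proof (unfold continuous_on_eq_continuous_within, rule ballI)
    fix y assume "y \<in> {0..d}"
    show "continuous (at y within {0..d}) F"
    proof (cases "y = 0")
      case True
      then show ?thesis
        using F0 assms by (simp add: continuous_within at_within_Icc_at_right F_def)
    next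
      case False
      with \<open>y \<in> {0..d}\<close> have "isCont F y"
        by (intro DERIV_isCont[OF dF]) auto
      then show ?thesis by (rule continuous_at_imp_continuous_at_within)
    qed
  qed
  \<comment> \<open>The derivative is known only for \<open>y > 0\<close>, hence the version for
    interior points.\<close>
  then have "((\<lambda>y. y ^ n * exp (- (z / sqrt y))) has_integral F d - F 0) {0..d}"
    using assms dF
    by (intro fundamental_theorem_of_calculus_interior)
      (auto simp: has_real_derivative_iff_has_vector_derivative)
  also have "F d - F 0 = d ^ (\<nu> + r + 1) * braced (z ^ 2 / (4 * d)) \<nu> r"
  proof -
    have a: "2 * sqrt (z ^ 2 / (4 * d)) = z / sqrt d"
      using assms by (simp add: real_sqrt_divide real_sqrt_mult)
    have "(sqrt d) ^ (2 * n + 2) = d ^ (n + 1)"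
      using assms power_mult[of "sqrt d" 2 "n + 1"] by simp
    then have "d ^ (n + 1) * (z / sqrt d) ^ (2 * n + 2) = z ^ (2 * n + 2)"
      using assms by (simp add: power_divide)
    moreover have "braced (z ^ 2 / (4 * d)) \<nu> r
        = 2 * ((z / sqrt d) ^ (2 * n + 2) * upper_Gamma_neg (2 * n + 2) (z / sqrt d))"
      using braced_eq_upper_Gamma_neg[of "z ^ 2 / (4 * d)" \<nu> r] assms
      unfolding a by (simp add: n_def)
    ultimately show ?thesis
      using assms by (simp add: F_def G_def n_def[symmetric] mult.assoc[symmetric] del: upper_Gamma_neg.simps)
  qed
  finally show ?thesis
    by (rule has_integral_eq[rotated]) (simp add: powr_minus_half_eq n_def)
qed

section \<open>Expansion of the exponential and termwise integration\<close>

theorem theorem5p2: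
  fixes z d :: real and \<nu> :: nat
  assumes "z > 0" and "d > 0"
  shows "I2_integrand z \<nu> integrable_on {0..d}
    \<and> (\<forall>r. summable (half_term (z ^ 2 / (4 * d)) \<nu> r)
           \<and> summable (int_term (z ^ 2 / (4 * d)) \<nu> r))
    \<and> summable (\<lambda>r. (- d) ^ r / fact r * braced (z ^ 2 / (4 * d)) \<nu> r)
    \<and> I2 z d \<nu> =
        d ^ (\<nu> + 1) * (\<Sum>r. (- d) ^ r / fact r * braced (z ^ 2 / (4 * d)) \<nu> r)"
proof -
  define u where "u = z ^ 2 / (4 * d)"
  have u: "u > 0" using assms by (simp add: u_def)
  define w where "w = (\<lambda>y. exp (- z * y powr (- 1 / 2)))"
  \<comment> \<open>Partial sums of the expansion of \<open>exp (- y)\<close>, times the remaining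
    factors of the integrand.\<close>
  define f where "f = (\<lambda>k y. \<Sum>r<k. (- 1) ^ r / fact r * (y ^ (\<nu> + r) * w y))"
  have f_eq: "f k y = y ^ \<nu> * w y * (\<Sum>r<k. (- y) ^ r / fact r)" for k y
    by (simp add: f_def sum_distrib_left power_add power_minus[of y] mult_ac)
  have f_int: "(f k has_integral (\<Sum>r<k. (- 1) ^ r / fact r * (d ^ (\<nu> + r + 1) * braced u \<nu> r))) {0..d}" for k
    unfolding f_def w_def u_def
    by (intro has_integral_sum has_integral_mult_right power_exp_has_integral assms) auto
  \<comment> \<open>The partial sums at \<open>- y\<close> are at most \<open>exp y\<close> in
    absolute value and \<open>w y \<le> 1\<close>, which gives a constant majorant independent of
    \<open>k\<close>.\<close>
  have bound: "norm (f k y) \<le> d ^ \<nu> * exp d" if y: "y \<in> {0..d}" for k y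
  proof -
    have "\<bar>\<Sum>r<k. (- y) ^ r / fact r\<bar> \<le> (\<Sum>r<k. \<bar>(- y) ^ r / fact r\<bar>)"
      by (rule sum_abs)
    also have "\<dots> = (\<Sum>r<k. y ^ r / fact r)"
      using y by (simp add: power_abs)
    also have "\<dots> \<le> (\<Sum>r. y ^ r / fact r)"
      using y by (intro sum_le_suminf summable_power_over_fact) auto
    also have "\<dots> = exp y"
      by (simp add: exp_def divide_inverse mult.commute)
    also have "\<dots> \<le> exp d"
      using y by simp
    finally have sum_le: "\<bar>\<Sum>r<k. (- y) ^ r / fact r\<bar> \<le> exp d" .
    have "y ^ \<nu> * w y \<le> d ^ \<nu> * 1"
      using y assms by (intro mult_mono power_mono) (auto simp: w_def)
    then have "(y ^ \<nu> * w y) * \<bar>\<Sum>r<k. (- y) ^ r / fact r\<bar> \<le> (d ^ \<nu> * 1) * exp d"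
      by (rule mult_mono[OF _ sum_le]) (use assms in auto)
    then show ?thesis
      using y by (simp add: f_eq abs_mult w_def)
  qed
  have lim: "(\<lambda>k. f k y) \<longlonglongrightarrow> I2_integrand z \<nu> y" for y
  proof -
    have "(\<lambda>r. (- y) ^ r / fact r) sums exp (- y)"
      using exp_converges[of "- y"] by (simp add: divide_inverse mult.commute)
    then have "(\<lambda>k. y ^ \<nu> * w y * (\<Sum>r<k. (- y) ^ r / fact r)) \<longlonglongrightarrow> y ^ \<nu> * w y * exp (- y)"
      unfolding sums_def by (intro tendsto_intros)
    then show ?thesis
      by (simp add: f_eq I2_integrand_def w_def mult_ac)
  qed
  have "(\<lambda>y. d ^ \<nu> * exp d) integrable_on {0..d}"
    by (rule integrable_const_ivl)
  note dom = dominated_convergence[OF has_integral_integrable[OF f_int] this bound lim]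
  have "(\<lambda>r. (- 1) ^ r / fact r * (d ^ (\<nu> + r + 1) * braced u \<nu> r)) sums I2 z d \<nu>"
    using dom(2) unfolding sums_def I2_def integral_unique[OF f_int] .
  \<comment> \<open>The division leaves \<open>d ^ r\<close>, which joins \<open>(- 1) ^ r\<close>
    to form \<open>(- d) ^ r\<close>.\<close>
  from sums_divide[OF this, of "d ^ (\<nu> + 1)"]
  have "(\<lambda>r. (- d) ^ r / fact r * braced u \<nu> r) sums (I2 z d \<nu> / d ^ (\<nu> + 1))"
    using assms by (simp add: power_add power_minus[of d] mult_ac)
  then show ?thesis
    using dom(1) summable_half_term[OF u] summable_int_term[OF less_imp_le[OF u]] assms
    by (simp add: sums_iff u_def[symmetric])
qed

end
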